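(* Let $D\subseteq\mathbb{C}_\infty$ be a domain, let $\mathcal{F}\subseteq\mathcal{M}(D)$ and let $h\in\mathcal{M}(D)$. Then $\mathcal{F}$ is normal in $D$ if and only if for each $z_0\in D$ there exist a neighbourhood $D(z_0;r)\subseteq D$ of $z_0$ and numbers $\epsilon_1,\epsilon_2$ with $0<\epsilon_1<\epsilon_2<\pi$ such that each $f\in\mathcal{F}$ satisfies $$\sigma(f(z),h(z))>\epsilon_1\ \text{ for all } z\in D(z_0;r)\qquad\text{or}\qquad \sigma(f(z),h(z))<\epsilon_2\ \text{ for all } z\in D(z_0;r).$$
   Context: $\mathbb{C}_\infty=\mathbb{C}\cup\{\infty\}$ is the Riemann sphere and $\sigma$ is the spherical metric on it (great-circle distance on the unit sphere, so the diameter is $\pi$). $\mathcal{M}(D)$ is the class of all meromorphic functions on the domain $D$, regarded as maps into $\mathbb{C}_\infty$. $D(z_0;r)$ denotes the open disc of centre $z_0$ and radius $r>0$ (a spherical disc if $z_0=\infty$). A family $\mathcal{F}\subseteq\mathcal{M}(D)$ is normal on $D$ if every sequence in $\mathcal{F}$ has a subsequence converging locally uniformly on $D$ with respect to $\sigma$ to a limit function which is either meromorphic on $D$ or identically $\infty$. *)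

theory Defs
  imports "HOL-Complex_Analysis.Complex_Analysis"
begin

datatype riemann_sphere = Cplx complex | Infty

text \<open>Inverse stereographic projection onto the unit sphere of the Euclidean 3-space
  \<open>complex \<times> real\<close>; the north pole \<open>(0, 1)\<close> corresponds to the point at infinity.\<close>

fun stereo :: "riemann_sphere \<Rightarrow> complex \<times> real" where
  "stereo (Cplx z) = ((2 / (1 + (cmod z)\<^sup>2)) *\<^sub>R z, ((cmod z)\<^sup>2 - 1) / ((cmod z)\<^sup>2 + 1))"
| "stereo Infty = (0, 1)"

lemma norm_stereo: "norm (stereo p) = 1"
proof (cases p)
  case (Cplx z)
  define t where "t = (cmod z)\<^sup>2"
  have t: "0 \<le> t" by (simp add: t_def)
  have "(norm (stereo p))\<^sup>2 = (2 / (1 + t))\<^sup>2 * t + ((t - 1) / (t + 1))\<^sup>2"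
    by (simp add: Cplx norm_prod_def power_mult_distrib t_def power_divide)
  also have "\<dots> = (4 * t + (t - 1)\<^sup>2) / (t + 1)\<^sup>2"
    by (simp add: power_divide add_divide_distrib add.commute)
  also have "4 * t + (t - 1)\<^sup>2 = (t + 1)\<^sup>2"
    by (simp add: power2_eq_square algebra_simps)
  finally have "(norm (stereo p))\<^sup>2 = 1" using t by simp
  then show ?thesis
    by (metis norm_ge_zero one_power2 power2_eq_imp_eq zero_le_one)
qed (simp add: norm_prod_def)

lemma stereo_inject: "stereo p = stereo q \<Longrightarrow> p = q"
proof -
  assume eq: "stereo p = stereo q"
  have pos: "1 + (cmod z)\<^sup>2 > 0" for z by (simp add: add_pos_nonneg)
  have ne: "((cmod z)\<^sup>2 - 1) / ((cmod z)\<^sup>2 + 1) \<noteq> 1" for z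
    using pos[of z] by (simp add: divide_simps)
  show ?thesis
  proof (cases p; cases q)
    fix z w assume pq: "p = Cplx z" "q = Cplx w"
    have "((cmod z)\<^sup>2 - 1) / ((cmod z)\<^sup>2 + 1) = ((cmod w)\<^sup>2 - 1) / ((cmod w)\<^sup>2 + 1)"
      using eq pq by simp
    then have *: "(cmod z)\<^sup>2 = (cmod w)\<^sup>2"
      using pos[of z] pos[of w] by (simp add: divide_simps algebra_simps split: if_splits)
    have "(2 / (1 + (cmod z)\<^sup>2)) *\<^sub>R z = (2 / (1 + (cmod w)\<^sup>2)) *\<^sub>R w"
      using eq pq by simp
    then have "(2 / (1 + (cmod w)\<^sup>2)) *\<^sub>R z = (2 / (1 + (cmod w)\<^sup>2)) *\<^sub>R w"
      by (simp only: *)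
    moreover have "2 / (1 + (cmod w)\<^sup>2) \<noteq> 0" using pos[of w] by simp
    ultimately have "z = w" using real_vector.scale_left_imp_eq by blast
    then show ?thesis using pq by simp
  next
    fix z assume "p = Cplx z" "q = Infty"
    then show ?thesis using eq ne[of z] by simp
  next
    fix w assume "p = Infty" "q = Cplx w"
    then show ?thesis using eq ne[of w] by (metis snd_conv stereo.simps)
  qed simp
qed

lemma inner_stereo_bounds: "- 1 \<le> stereo p \<bullet> stereo q" "stereo p \<bullet> stereo q \<le> 1"
  using Cauchy_Schwarz_ineq2[of "stereo p" "stereo q"] by (simp_all add: norm_stereo abs_le_iff)

lemma arccos_inner_triangle:
  fixes x y z :: "'a::real_inner"
  assumes n: "norm x = 1" "norm y = 1" "norm z = 1"
  shows "arccos (x \<bullet> z) \<le> arccos (x \<bullet> y) + arccos (y \<bullet> z)"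
proof -
  have b: "-1 \<le> u \<bullet> v" "u \<bullet> v \<le> 1" if "norm u = 1" "norm v = 1" for u v :: 'a
    using Cauchy_Schwarz_ineq2[of u v] that by (simp_all add: abs_le_iff)
  define a where "a = x \<bullet> y"
  define c where "c = y \<bullet> z"
  have ac: "-1 \<le> a" "a \<le> 1" "-1 \<le> c" "c \<le> 1"
    using b n by (auto simp: a_def c_def)
  have sq: "x \<bullet> x = 1" "y \<bullet> y = 1" "z \<bullet> z = 1"
    using n by (simp_all add: dot_square_norm)
  have n1: "norm (x - a *\<^sub>R y) = sqrt (1 - a\<^sup>2)"
    unfolding norm_eq_sqrt_inner
    by (simp add: inner_diff_left inner_diff_right sq a_def[symmetric] inner_commute[of y x] power2_eq_square)
  have n2: "norm (z - c *\<^sub>R y) = sqrt (1 - c\<^sup>2)"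
    unfolding norm_eq_sqrt_inner
    by (simp add: inner_diff_left inner_diff_right sq c_def[symmetric] inner_commute[of z y] power2_eq_square)
  have i: "(x - a *\<^sub>R y) \<bullet> (z - c *\<^sub>R y) = x \<bullet> z - a * c"
    by (simp add: inner_diff_left inner_diff_right sq a_def[symmetric] c_def[symmetric])
  have "\<bar>x \<bullet> z - a * c\<bar> \<le> sqrt (1 - a\<^sup>2) * sqrt (1 - c\<^sup>2)"
    using Cauchy_Schwarz_ineq2[of "x - a *\<^sub>R y" "z - c *\<^sub>R y"] unfolding i n1 n2 .
  then have le: "cos (arccos a + arccos c) \<le> x \<bullet> z"
    using ac by (simp add: cos_add sin_arccos)
  show ?thesis
  proof (cases "arccos a + arccos c \<le> pi")
    case True
    then have "arccos (x \<bullet> z) \<le> arccos (cos (arccos a + arccos c))"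
      using le b[OF n(1) n(3)] by (intro arccos_le_arccos) auto
    also have "\<dots> = arccos a + arccos c"
      using True ac by (intro arccos_cos) (auto simp: arccos_lbound)
    finally show ?thesis by (simp add: a_def c_def)
  next
    case False
    then show ?thesis using arccos_ubound[OF b[OF n(1) n(3)]] by (simp add: a_def c_def)
  qed
qed

text \<open>\<open>dist\<close> is the spherical metric: the great-circle distance of two points of the unit
  sphere is the angle between them. The topology is the induced one.\<close>

instantiation riemann_sphere :: metric_space
begin

definition dist_riemann_sphere :: "riemann_sphere \<Rightarrow> riemann_sphere \<Rightarrow> real" where
  "dist p q = arccos (stereo p \<bullet> stereo q)"

definition uniformity_riemann_sphere :: "(riemann_sphere \<times> riemann_sphere) filter" where
  "uniformity = (INF e\<in>{0<..}. principal {(p, q). dist (p::riemann_sphere) q < e})"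

definition open_riemann_sphere :: "riemann_sphere set \<Rightarrow> bool" where
  "open (U :: riemann_sphere set) \<longleftrightarrow> (\<forall>p\<in>U. eventually (\<lambda>(p', q). p' = p \<longrightarrow> q \<in> U) uniformity)"

instance
proof
  fix p q r :: riemann_sphere
  show "dist p q = 0 \<longleftrightarrow> p = q"
  proof
    assume "dist p q = 0"
    then have "cos (arccos (stereo p \<bullet> stereo q)) = 1" by (simp add: dist_riemann_sphere_def)
    then have "stereo p \<bullet> stereo q = 1" using inner_stereo_bounds[of p q] by simp
    moreover have "(norm (stereo p - stereo q))\<^sup>2 =
        (norm (stereo p))\<^sup>2 - 2 * (stereo p \<bullet> stereo q) + (norm (stereo q))\<^sup>2"
      by (simp only: power2_norm_eq_inner inner_diff_left inner_diff_right
          inner_commute[of "stereo q" "stereo p"])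
    ultimately have "(norm (stereo p - stereo q))\<^sup>2 = 0"
      by (simp only: norm_stereo) simp
    then show "p = q" by (intro stereo_inject) simp
  qed (simp add: dist_riemann_sphere_def dot_square_norm norm_stereo)
  show "dist p q \<le> dist p r + dist q r"
    using arccos_inner_triangle[of "stereo p" "stereo r" "stereo q"]
    by (simp add: dist_riemann_sphere_def norm_stereo inner_commute)
qed (simp_all only: uniformity_riemann_sphere_def open_riemann_sphere_def)

end

text \<open>\<open>g\<close> is a function of a local complex coordinate: near \<open>a\<close> it is either
  holomorphic, or it has a pole at \<open>a\<close>, where it takes the value \<open>Infty\<close>.\<close>

definition meromorphic_at :: "(complex \<Rightarrow> riemann_sphere) \<Rightarrow> complex \<Rightarrow> bool" where
  "meromorphic_at g a \<longleftrightarrow>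
     (\<exists>G. G analytic_on {a} \<and> (\<forall>\<^sub>F z in nhds a. g z = Cplx (G z))) \<or>
     (g a = Infty \<and>
       (\<exists>G. isolated_singularity_at G a \<and> is_pole G a \<and> (\<forall>\<^sub>F z in at a. g z = Cplx (G z))))"

text \<open>The local coordinate \<open>w = 1 / z\<close> at the point at infinity.\<close>

definition chart_infty :: "complex \<Rightarrow> riemann_sphere" where
  "chart_infty w = (if w = 0 then Infty else Cplx (1 / w))"

text \<open>Functions are total; only their values on \<open>D\<close> matter here and below.\<close>

definition meromorphic_funs :: "riemann_sphere set \<Rightarrow> (riemann_sphere \<Rightarrow> riemann_sphere) set" where
  "meromorphic_funs D =
     {f. (\<forall>a. Cplx a \<in> D \<longrightarrow> meromorphic_at (\<lambda>z. f (Cplx z)) a) \<and>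
         (Infty \<in> D \<longrightarrow> meromorphic_at (\<lambda>w. f (chart_infty w)) 0)}"

text \<open>Euclidean discs about finite points, spherical discs about \<open>Infty\<close>.\<close>

fun disc :: "riemann_sphere \<Rightarrow> real \<Rightarrow> riemann_sphere set" where
  "disc (Cplx a) r = Cplx ` ball a r"
| "disc Infty r = ball Infty r"

definition locally_uniform_limit ::
  "riemann_sphere set \<Rightarrow> (nat \<Rightarrow> riemann_sphere \<Rightarrow> riemann_sphere) \<Rightarrow>
   (riemann_sphere \<Rightarrow> riemann_sphere) \<Rightarrow> bool" where
  "locally_uniform_limit D s g \<longleftrightarrow>
     (\<forall>z\<in>D. \<exists>U. open U \<and> z \<in> U \<and> U \<subseteq> D \<and> uniform_limit U s g sequentially)"

definition normal_family ::
  "riemann_sphere set \<Rightarrow> (riemann_sphere \<Rightarrow> riemann_sphere) set \<Rightarrow> bool" where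
  "normal_family D F \<longleftrightarrow>
     (\<forall>s :: nat \<Rightarrow> riemann_sphere \<Rightarrow> riemann_sphere. range s \<subseteq> F \<longrightarrow>
       (\<exists>(k :: nat \<Rightarrow> nat) g. strict_mono k \<and> locally_uniform_limit D (s \<circ> k) g \<and>
          (g \<in> meromorphic_funs D \<or> (\<forall>z\<in>D. g z = Infty))))"

end

theory Submission
  imports Defs
begin

text \<open>
  Normality gives the alternative by continuity. If it failed at a point, for a fixed pair
  \<open>\<epsilon>1 < \<epsilon>2\<close>, then on arbitrarily small discs some \<open>f\<close> in the family would have a value at
  distance at most \<open>\<epsilon>1\<close> and a value at distance at least \<open>\<epsilon>2\<close> from \<open>h\<close>. A locally uniform
  limit \<open>g\<close> of a sequence of such \<open>f\<close> is continuous, so the distance of \<open>g\<close> and \<open>h\<close> at the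
  point would be both at most \<open>\<epsilon>1\<close> and at least \<open>\<epsilon>2\<close>. Any such pair with
  \<open>0 < \<epsilon>1\<close> and \<open>\<epsilon>2 < pi\<close> works, for instance \<open>pi / 4\<close> and \<open>pi / 2\<close> (\<open>normal_imp_separated_or_close\<close>).

  For the converse, the key is that \<open>dist x q = pi - dist x c\<close> for the antipode \<open>q\<close> of \<open>c\<close>
  (\<open>ex_antipode\<close>). Staying at distance less than \<open>\<epsilon>2 < pi\<close> from \<open>h\<close> therefore means staying away
  from the antipode of \<open>h\<close>, and \<open>h\<close> is almost constant near a point \<open>z0\<close>. So near \<open>z0\<close> every
  member of the family omits a fixed ball about \<open>h z0\<close> or a fixed ball about its antipode
  (\<open>separated_or_close_avoids_point\<close>). Functions that omit a ball about one point \<open>c\<close> become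
  uniformly bounded holomorphic functions in an affine coordinate of the sphere without \<open>c\<close>, and
  the classical theorem of Montel applies (\<open>Montel_avoiding_ball\<close>). The coordinate of a limit is
  again holomorphic, so the limit is a holomorphic map into the sphere.

  These local limits are glued by a countable cover and a diagonal sequence
  (\<open>locally_normal_imp_normal\<close>). It remains that a holomorphic map from a connected set into
  the sphere is meromorphic or constantly \<open>Infty\<close> (\<open>meromorphic_or_Infty\<close>): near each point it
  is either identically \<open>Infty\<close> or takes the value \<open>Infty\<close> at most at the point itself, and
  each alternative holds on an open set.
\<close>

section \<open>The topology of the sphere\<close>

lemma norm_stereo_diff_sq: "(norm (stereo p - stereo q))\<^sup>2 = 2 - 2 * cos (dist p q)"
proof -
  have "(norm (stereo p - stereo q))\<^sup>2 =
      (norm (stereo p))\<^sup>2 - 2 * (stereo p \<bullet> stereo q) + (norm (stereo q))\<^sup>2"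
    by (simp only: power2_norm_eq_inner inner_diff_left inner_diff_right
        inner_commute[of "stereo q" "stereo p"])
  then show ?thesis
    using inner_stereo_bounds[of p q] by (simp add: norm_stereo dist_riemann_sphere_def)
qed

text \<open>The spherical metric and the chord metric determine each other by the preceding formula, hence
  \<open>stereo\<close> is a topological embedding. This reduces all continuity questions on the sphere to
  formulas in Euclidean space.\<close>
lemma tendsto_stereo_iff: "((\<lambda>x. stereo (f x)) \<longlongrightarrow> stereo p) F \<longleftrightarrow> (f \<longlongrightarrow> p) F"
proof
  assume L: "((\<lambda>x. stereo (f x)) \<longlongrightarrow> stereo p) F"
  have "((\<lambda>x. stereo (f x) \<bullet> stereo p) \<longlongrightarrow> stereo p \<bullet> stereo p) F"
    by (intro tendsto_intros L)
  then have "((\<lambda>x. stereo (f x) \<bullet> stereo p) \<longlongrightarrow> 1) F"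
    by (simp add: dot_square_norm norm_stereo)
  then have "((\<lambda>x. arccos (stereo (f x) \<bullet> stereo p)) \<longlongrightarrow> arccos 1) F"
    by (rule continuous_on_tendsto_compose[OF continuous_on_arccos'])
       (auto simp: inner_stereo_bounds)
  then have "((\<lambda>x. dist (f x) p) \<longlongrightarrow> 0) F"
    by (simp add: dist_riemann_sphere_def)
  then show "(f \<longlongrightarrow> p) F" by (rule tendsto_dist_iff[THEN iffD2])
next
  assume L: "(f \<longlongrightarrow> p) F"
  have "((\<lambda>x. dist (f x) p) \<longlongrightarrow> 0) F"
    using L by (rule tendsto_dist_iff[THEN iffD1])
  then have "((\<lambda>x. 2 - 2 * cos (dist (f x) p)) \<longlongrightarrow> 2 - 2 * cos 0) F"
    by (intro tendsto_diff tendsto_mult tendsto_const isCont_tendsto_compose[OF isCont_cos])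
  then have "((\<lambda>x. (norm (stereo (f x) - stereo p))\<^sup>2) \<longlongrightarrow> 0) F"
    by (simp add: norm_stereo_diff_sq)
  then have "((\<lambda>x. norm (stereo (f x) - stereo p)) \<longlongrightarrow> 0) F"
    using tendsto_real_sqrt[of "\<lambda>x. (norm (stereo (f x) - stereo p))\<^sup>2" 0 F] by simp
  then show "((\<lambda>x. stereo (f x)) \<longlongrightarrow> stereo p) F"
    unfolding tendsto_dist_iff[of "\<lambda>x. stereo (f x)"] dist_norm .
qed

lemma continuous_on_stereo: "continuous_on S stereo"
  unfolding continuous_on_def
proof
  fix p assume "p \<in> S"
  show "(stereo \<longlongrightarrow> stereo p) (at p within S)"
    by (rule tendsto_stereo_iff[THEN iffD2]) (rule tendsto_ident_at)
qed

lemma continuous_on_sphere_iff: "continuous_on S f \<longleftrightarrow> continuous_on S (\<lambda>x. stereo (f x))"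
  by (simp add: continuous_on_def tendsto_stereo_iff)

lemma one_plus_norm_sq_pos: "1 + (cmod z)\<^sup>2 > 0"
  by (simp add: add_pos_nonneg)

lemma one_plus_norm_sq_neq_0: "1 + (cmod z)\<^sup>2 \<noteq> 0" "(cmod z)\<^sup>2 + 1 \<noteq> 0"
  using one_plus_norm_sq_pos[of z] by linarith+

lemma continuous_on_Cplx: "continuous_on S Cplx"
  unfolding continuous_on_sphere_iff
  unfolding stereo.simps
  by (intro continuous_intros ballI one_plus_norm_sq_neq_0)
  
text \<open>The inversion \<open>z \<mapsto> 1 / z\<close> is the rotation \<open>(u, t) \<mapsto> (cnj u, - t)\<close> of the unit sphere, so
  \<open>chart_infty\<close> has the same shape as \<open>Cplx\<close>, with no case distinction at \<open>0\<close>.\<close>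
lemma stereo_chart_infty:
  "stereo (chart_infty w) = ((2 / (1 + (cmod w)\<^sup>2)) *\<^sub>R cnj w, (1 - (cmod w)\<^sup>2) / (1 + (cmod w)\<^sup>2))"
proof (cases "w = 0")
  case False
  define t where "t = (cmod w)\<^sup>2"
  have t: "t > 0" using False by (simp add: t_def)
  have cn: "cnj w = complex_of_real t / w"
    using False complex_norm_square[of w] by (simp add: t_def field_simps)
  have "2 / (1 + 1 / t) = 2 / (1 + t) * t" using t by (simp add: field_simps)
  moreover have "(1 / t - 1) / (1 / t + 1) = (1 - t) / (1 + t)"
    using t by (simp add: divide_simps)
  moreover have "(cmod (1 / w))\<^sup>2 = 1 / t" by (simp add: t_def norm_divide power_divide)
  ultimately show ?thesis
    using False
    by (simp only: chart_infty_def if_False stereo.simps t_def[symmetric] cn)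
       (simp add: scaleR_conv_of_real)
qed (simp add: chart_infty_def)

lemma continuous_on_chart_infty: "continuous_on S chart_infty"
  unfolding continuous_on_sphere_iff stereo_chart_infty
  by (intro continuous_intros ballI one_plus_norm_sq_neq_0)

lemma range_chart_infty: "range chart_infty = - {Cplx 0}"
proof -
  have "p \<in> range chart_infty" if "p \<noteq> Cplx 0" for p
  proof (cases p)
    case (Cplx z)
    then have "p = chart_infty (1 / z)" using that by (simp add: chart_infty_def)
    then show ?thesis by blast
  next
    case Infty
    then have "p = chart_infty 0" by (simp add: chart_infty_def)
    then show ?thesis by blast
  qed
  moreover have "chart_infty w \<noteq> Cplx 0" for w by (simp add: chart_infty_def)
  ultimately show ?thesis by auto
qed

lemma range_Cplx: "range Cplx = - {Infty}"
proof -
  have "p \<in> range Cplx" if "p \<noteq> Infty" for p using that by (cases p) auto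
  then show ?thesis by auto
qed

lemma inj_Cplx: "inj Cplx"
  by (simp add: inj_def)

lemma inj_chart_infty: "inj chart_infty"
  by (auto simp: inj_def chart_infty_def split: if_splits)

lemma scaleR_left_inverse: "c \<noteq> 0 \<Longrightarrow> (c *\<^sub>R z) /\<^sub>R c = (z :: complex)"
  by simp

text \<open>The tool that turns explicit inverses of the two charts into openness of the charts.\<close>
lemma open_image_left_inverse:
  assumes c: "continuous_on (range f) g" and o: "open (range f)"
    and gf: "\<And>x. g (f x) = x" and V: "open V"
  shows "open (f ` V)"
proof -
  have "f ` V = g -` V \<inter> range f" using gf by auto
  then show ?thesis using continuous_on_open_vimage[OF o, of g] c V by metis
qed

lemma snd_stereo_Cplx_neq_1: "snd (stereo (Cplx z)) \<noteq> 1"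
  using one_plus_norm_sq_pos[of z] by (simp add: divide_simps)

lemma snd_stereo_chart_infty_neq_m1: "snd (stereo (chart_infty z)) \<noteq> - 1"
  unfolding stereo_chart_infty using one_plus_norm_sq_pos[of z] by (simp add: divide_simps)

lemma open_Cplx_image: "open V \<Longrightarrow> open (Cplx ` V)"
  \<comment> \<open>The left inverse is the projection from the north pole, \<open>(u, t) \<mapsto> u / (1 - t)\<close>.\<close>
proof (rule open_image_left_inverse[where g="\<lambda>p. fst (stereo p) /\<^sub>R (1 - snd (stereo p))"])
  show "continuous_on (range Cplx) (\<lambda>p. fst (stereo p) /\<^sub>R (1 - snd (stereo p)))"
    using snd_stereo_Cplx_neq_1
    by (intro continuous_intros continuous_on_stereo) (auto simp del: stereo.simps)
  show "open (range Cplx)" by (simp add: range_Cplx open_Compl)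
  fix z
  have "1 - ((cmod z)\<^sup>2 - 1) / ((cmod z)\<^sup>2 + 1) = 2 / (1 + (cmod z)\<^sup>2)"
    using one_plus_norm_sq_pos[of z] by (simp add: divide_simps)
  then show "fst (stereo (Cplx z)) /\<^sub>R (1 - snd (stereo (Cplx z))) = z"
    using one_plus_norm_sq_neq_0[of z]
    by (simp only: stereo.simps stereo_chart_infty fst_conv snd_conv
          complex_cnj_scaleR complex_cnj_cnj)
       (rule scaleR_left_inverse, simp)
qed

lemma open_chart_infty_image: "open V \<Longrightarrow> open (chart_infty ` V)"
  \<comment> \<open>Here the projection is from the south pole, followed by conjugation.\<close>
proof (rule open_image_left_inverse[where g="\<lambda>p. cnj (fst (stereo p)) /\<^sub>R (1 + snd (stereo p))"])
  show "continuous_on (range chart_infty) (\<lambda>p. cnj (fst (stereo p)) /\<^sub>R (1 + snd (stereo p)))"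
    using snd_stereo_chart_infty_neq_m1
    by (intro continuous_intros continuous_on_stereo) (auto simp: add_eq_0_iff)
  show "open (range chart_infty)" by (simp add: range_chart_infty open_Compl)
  fix z
  have "1 + (1 - (cmod z)\<^sup>2) / (1 + (cmod z)\<^sup>2) = 2 / (1 + (cmod z)\<^sup>2)"
    using one_plus_norm_sq_pos[of z] by (simp add: divide_simps)
  then show "cnj (fst (stereo (chart_infty z))) /\<^sub>R (1 + snd (stereo (chart_infty z))) = z"
    using one_plus_norm_sq_neq_0[of z]
    by (simp only: stereo.simps stereo_chart_infty fst_conv snd_conv
          complex_cnj_scaleR complex_cnj_cnj)
       (rule scaleR_left_inverse, simp)
qed

lemma isCont_Cplx: "isCont Cplx a" and isCont_chart_infty: "isCont chart_infty a"
  using continuous_on_Cplx[of UNIV] continuous_on_chart_infty[of UNIV]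
  by (auto simp: continuous_on_eq_continuous_at)

lemma filtermap_Cplx_nhds: "filtermap Cplx (nhds a) = nhds (Cplx a)"
  by (intro filtermap_nhds_open_map isCont_Cplx open_Cplx_image)

lemma filtermap_chart_infty_nhds: "filtermap chart_infty (nhds a) = nhds (chart_infty a)"
  by (intro filtermap_nhds_open_map isCont_chart_infty open_chart_infty_image)

text \<open>The antipodal map of the unit sphere sends the point \<open>z\<close> to \<open>- 1 / cnj z\<close>, which
  \<open>chart_infty\<close> describes also for \<open>z = 0\<close>; the formula for the distance is
  \<open>arccos (- x) = pi - arccos x\<close>.\<close>
lemma ex_antipode:
  fixes p :: riemann_sphere
  shows "\<exists>q. \<forall>x. dist x q = pi - dist x p"
proof -
  have "\<exists>q. stereo q = - stereo p"
  proof (cases p)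
    case Infty
    then have "stereo (Cplx 0) = - stereo p" by simp
    then show ?thesis ..
  next
    case (Cplx z)
    have "stereo (chart_infty (- cnj z)) = - stereo p"
      by (simp add: stereo_chart_infty Cplx add.commute minus_divide_left)
    then show ?thesis ..
  qed
  then obtain q where q: "stereo q = - stereo p" ..
  have "dist x q = pi - dist x p" for x
    using inner_stereo_bounds[of x p] by (simp add: dist_riemann_sphere_def q arccos_minus)
  then show ?thesis by blast
qed

lemma eventually_nhds_disc:
  "eventually P (nhds z) \<longleftrightarrow> (\<exists>r>0. \<forall>x\<in>disc z r. P x)"
proof (cases z)
  case (Cplx a)
  have "eventually P (nhds z) \<longleftrightarrow> eventually (\<lambda>w. P (Cplx w)) (nhds a)"
    by (simp add: Cplx filtermap_Cplx_nhds[symmetric] eventually_filtermap)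
  then show ?thesis
    by (auto simp: Cplx eventually_nhds_metric dist_commute)
qed (auto simp: eventually_nhds_metric dist_commute)

lemma disc_mono: "r \<le> r' \<Longrightarrow> disc z r \<subseteq> disc z r'"
  by (cases z) auto

lemma open_disc: "open (disc z r)"
  by (cases z) (auto intro: open_Cplx_image)

lemma centre_in_disc: "0 < r \<Longrightarrow> z \<in> disc z r"
  by (cases z) auto


section \<open>Holomorphic maps into the sphere\<close>

text \<open>Unlike \<open>meromorphic_at\<close>, this notion includes the constant \<open>Infty\<close>. It is
  symmetric in the two charts of the target and closed under locally uniform limits.\<close>
definition sphere_holomorphic_at :: "(complex \<Rightarrow> riemann_sphere) \<Rightarrow> complex \<Rightarrow> bool" where
  "sphere_holomorphic_at g a \<longleftrightarrow>
     (\<exists>H. H analytic_on {a} \<and>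
        ((\<forall>\<^sub>F z in nhds a. g z = Cplx (H z)) \<or> (\<forall>\<^sub>F z in nhds a. g z = chart_infty (H z))))"

lemma sphere_holomorphic_at_Cplx:
  "H analytic_on {a} \<Longrightarrow> \<forall>\<^sub>F z in nhds a. g z = Cplx (H z) \<Longrightarrow> sphere_holomorphic_at g a"
  by (auto simp: sphere_holomorphic_at_def)

lemma sphere_holomorphic_at_chart_infty:
  "H analytic_on {a} \<Longrightarrow> \<forall>\<^sub>F z in nhds a. g z = chart_infty (H z) \<Longrightarrow> sphere_holomorphic_at g a"
  by (auto simp: sphere_holomorphic_at_def)

lemma sphere_holomorphic_atE:
  assumes "sphere_holomorphic_at g a"
  obtains (Cplx) H where "H analytic_on {a}" "\<forall>\<^sub>F z in nhds a. g z = Cplx (H z)"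
        | (chart_infty) H where "H analytic_on {a}" "\<forall>\<^sub>F z in nhds a. g z = chart_infty (H z)"
  using assms by (auto simp: sphere_holomorphic_at_def)

lemma sphere_holomorphic_at_transform:
  assumes "sphere_holomorphic_at g a" and ev: "\<forall>\<^sub>F z in nhds a. f z = g z"
  shows "sphere_holomorphic_at f a"
  using assms(1)
proof (cases rule: sphere_holomorphic_atE)
  case (Cplx H)
  from Cplx(2) ev have "\<forall>\<^sub>F z in nhds a. f z = Cplx (H z)"
    by eventually_elim simp
  then show ?thesis by (rule sphere_holomorphic_at_Cplx[OF Cplx(1)])
next
  case (chart_infty H)
  from chart_infty(2) ev have "\<forall>\<^sub>F z in nhds a. f z = chart_infty (H z)"
    by eventually_elim simp
  then show ?thesis by (rule sphere_holomorphic_at_chart_infty[OF chart_infty(1)])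
qed

lemma analytic_at_eventually_compose:
  assumes "K analytic_on {b}" and "eventually P (nhds (K b))"
  shows "\<forall>\<^sub>F z in nhds b. P (K z)"
proof -
  have "filterlim K (nhds (K b)) (nhds b)"
    using analytic_at_imp_isCont[OF assms(1)]
    by (simp add: continuous_at tendsto_at_iff_tendsto_nhds)
  then show ?thesis using assms(2) by (auto simp: filterlim_iff)
qed

lemma sphere_holomorphic_at_compose:
  assumes g: "sphere_holomorphic_at g (K b)" and K: "K analytic_on {b}"
  shows "sphere_holomorphic_at (\<lambda>z. g (K z)) b"
  using g
proof (cases rule: sphere_holomorphic_atE)
  case (Cplx H)
  have "(H \<circ> K) analytic_on {b}" using K Cplx(1) by (intro analytic_on_compose) auto
  then show ?thesis
    using analytic_at_eventually_compose[OF K Cplx(2)]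
    by (intro sphere_holomorphic_at_Cplx) (auto simp: o_def)
next
  case (chart_infty H)
  have "(H \<circ> K) analytic_on {b}" using K chart_infty(1) by (intro analytic_on_compose) auto
  then show ?thesis
    using analytic_at_eventually_compose[OF K chart_infty(2)]
    by (intro sphere_holomorphic_at_chart_infty) (auto simp: o_def)
qed

text \<open>The points with value \<open>Infty\<close> are zeros of an analytic function, and these are isolated unless the
  function vanishes identically.\<close>
lemma sphere_holomorphic_at_Infty_dichotomy:
  assumes "sphere_holomorphic_at g a"
  shows "(\<forall>\<^sub>F z in nhds a. g z = Infty) \<or> (\<forall>\<^sub>F z in at a. g z \<noteq> Infty)"
  using assms
proof (cases rule: sphere_holomorphic_atE)
  case (Cplx H)
  then have "\<forall>\<^sub>F z in nhds a. g z \<noteq> Infty" by (auto elim: eventually_mono)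
  then show ?thesis by (auto simp: eventually_nhds_conv_at)
next
  case (chart_infty H)
  have eq: "\<forall>\<^sub>F z in at a. g z = chart_infty (H z)"
    using chart_infty(2) by (simp add: eventually_nhds_conv_at)
  consider "\<forall>\<^sub>F z in at a. H z \<noteq> 0" | "\<forall>\<^sub>F z in nhds a. H z = 0"
    using non_isolated_zero_imp_eventually_zero'[OF chart_infty(1)]
      isolated_zero_analytic_iff[OF chart_infty(1)]
      non_zero_neighbour[of H a]
      tendsto_imp_eventually_ne[OF isContD[OF analytic_at_imp_isCont[OF chart_infty(1)]], of 0]
    by blast
  then show ?thesis
  proof cases
    case 1
    with eq have "\<forall>\<^sub>F z in at a. g z \<noteq> Infty"
      by eventually_elim (simp add: chart_infty_def)
    then show ?thesis ..
  next
    case 2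
    with chart_infty(2) have "\<forall>\<^sub>F z in nhds a. g z = Infty"
      by eventually_elim (simp add: chart_infty_def)
    then show ?thesis ..
  qed
qed

lemma chart_infty_eq_Cplx_inverse: "w \<noteq> 0 \<Longrightarrow> chart_infty w = Cplx (inverse w)"
  by (simp add: chart_infty_def divide_inverse)

lemma Cplx_eq_chart_infty_inverse: "w \<noteq> 0 \<Longrightarrow> Cplx w = chart_infty (inverse w)"
  by (simp add: chart_infty_def divide_inverse)

text \<open>At a pole the reciprocal extends holomorphically by \<open>0\<close>, so it describes the function in the
  chart at \<open>Infty\<close>; conversely an isolated zero in that chart is a pole.\<close>
lemma meromorphic_at_iff:
  "meromorphic_at g a \<longleftrightarrow> sphere_holomorphic_at g a \<and> \<not> (\<forall>\<^sub>F z in nhds a. g z = Infty)"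
proof
  assume "meromorphic_at g a"
  then consider (regular) G where "G analytic_on {a}" "\<forall>\<^sub>F z in nhds a. g z = Cplx (G z)"
    | (pole) G where "g a = Infty" "isolated_singularity_at G a" "is_pole G a"
        "\<forall>\<^sub>F z in at a. g z = Cplx (G z)"
    unfolding meromorphic_at_def by blast
  then show "sphere_holomorphic_at g a \<and> \<not> (\<forall>\<^sub>F z in nhds a. g z = Infty)"
  proof cases
    case regular
    have "g a = Cplx (G a)" using regular(2) by (rule eventually_nhds_x_imp_x)
    then show ?thesis
      using sphere_holomorphic_at_Cplx[OF regular] eventually_nhds_x_imp_x by fastforce
  next
    case pole
    have nz: "\<forall>\<^sub>F z in at a. G z \<noteq> 0" using pole(3) by (rule non_zero_neighbour_pole)
    obtain r1 where r1: "r1 > 0" "G analytic_on ball a r1 - {a}"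
      using pole(2) by (auto simp: isolated_singularity_at_def)
    obtain r2 where r2: "r2 > 0" "\<And>z. z \<in> ball a r2 \<Longrightarrow> z \<noteq> a \<Longrightarrow> G z \<noteq> 0"
      using nz by (auto simp: eventually_at dist_commute)
    define r where "r = min r1 r2"
    define H where "H = (\<lambda>z. if z = a then 0 else inverse (G z))"
    have "H holomorphic_on ball a r"
      unfolding H_def
    proof (rule is_pole_inverse_holomorphic[OF open_ball _ pole(3)])
      show "G holomorphic_on ball a r - {a}"
        using r1(2) by (rule holomorphic_on_subset[OF analytic_imp_holomorphic]) (auto simp: r_def)
    qed (use r2(2) in \<open>auto simp: r_def\<close>)
    then have H: "H analytic_on {a}"
      using r1(1) r2(1) by (auto simp: analytic_at r_def intro!: exI[of _ "ball a r"])
    from pole(4) nz have "\<forall>\<^sub>F z in at a. g z = chart_infty (H z) \<and> g z \<noteq> Infty"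
      using eventually_neq_at_within[of a a UNIV]
      by eventually_elim (simp add: H_def chart_infty_def divide_inverse)
    then have at: "\<forall>\<^sub>F z in at a. g z = chart_infty (H z)" "\<forall>\<^sub>F z in at a. g z \<noteq> Infty"
      by (auto elim: eventually_mono)
    have "g a = chart_infty (H a)" using pole(1) by (simp add: H_def chart_infty_def)
    with at(1) have "sphere_holomorphic_at g a"
      by (intro sphere_holomorphic_at_chart_infty[OF H]) (simp add: eventually_nhds_conv_at)
    moreover have "\<not> (\<forall>\<^sub>F z in nhds a. g z = Infty)"
    proof
      assume "\<forall>\<^sub>F z in nhds a. g z = Infty"
      then have "\<forall>\<^sub>F z in at a. g z = Infty" by (simp add: eventually_nhds_conv_at)
      with at(2) have "\<forall>\<^sub>F z in at a. False" by eventually_elim simp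
      then show False by simp
    qed
    ultimately show ?thesis ..
  qed
next
  assume A: "sphere_holomorphic_at g a \<and> \<not> (\<forall>\<^sub>F z in nhds a. g z = Infty)"
  then have "sphere_holomorphic_at g a" ..
  then show "meromorphic_at g a"
  proof (cases rule: sphere_holomorphic_atE)
    case (Cplx H)
    then show ?thesis by (auto simp: meromorphic_at_def)
  next
    case (chart_infty H)
    show ?thesis
    proof (cases "H a = 0")
      case False
      then have "\<forall>\<^sub>F z in nhds a. H z \<noteq> 0"
        by (intro analytic_at_eventually_compose[OF chart_infty(1)] t1_space_nhds)
      with chart_infty(2) have "\<forall>\<^sub>F z in nhds a. g z = Cplx (inverse (H z))"
        by eventually_elim (simp add: chart_infty_eq_Cplx_inverse)
      moreover have "(\<lambda>z. inverse (H z)) analytic_on {a}"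
        using False chart_infty(1) by (intro analytic_intros) auto
      ultimately show ?thesis by (auto simp: meromorphic_at_def)
    next
      case True
      have "isolated_zero H a"
      proof (rule ccontr)
        assume "\<not> isolated_zero H a"
        then have "\<forall>\<^sub>F z in nhds a. H z = 0"
          using non_isolated_zero_imp_eventually_zero'[OF chart_infty(1) True] by blast
        with chart_infty(2) have "\<forall>\<^sub>F z in nhds a. g z = Infty"
          by eventually_elim (simp add: chart_infty_def)
        then show False using A by blast
      qed
      then have pole: "is_pole (\<lambda>z. inverse (H z)) a" and nz: "\<forall>\<^sub>F z in at a. H z \<noteq> 0"
        using isolated_zero_imp_pole_inverse isolated_zero_def by blast+
      have "\<forall>\<^sub>F z in at a. g z = chart_infty (H z)"
        using chart_infty(2) by (simp add: eventually_nhds_conv_at)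
      with nz have "\<forall>\<^sub>F z in at a. g z = Cplx (inverse (H z))"
        by eventually_elim (simp add: chart_infty_eq_Cplx_inverse)
      moreover have "isolated_singularity_at (\<lambda>z. inverse (H z)) a"
        using chart_infty(1) by (intro isolated_singularity_at_inverse
            isolated_singularity_at_analytic not_essential_analytic)
      moreover have "g a = Infty"
        using eventually_nhds_x_imp_x[OF chart_infty(2)] True by (simp add: chart_infty_def)
      ultimately show ?thesis
        using pole unfolding meromorphic_at_def by blast
    qed
  qed
qed

lemma isCont_sphere_holomorphic_at:
  assumes "sphere_holomorphic_at g a"
  shows "isCont g a"
proof -
  have *: "isCont g a" if H: "H analytic_on {a}" and ev: "\<forall>\<^sub>F z in nhds a. g z = \<kappa> (H z)"
    and \<kappa>: "isCont \<kappa> (H a)" for H \<kappa>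
  proof -
    have "isCont (\<lambda>z. \<kappa> (H z)) a"
      using \<kappa> analytic_at_imp_isCont[OF H] by (rule isCont_o2[rotated])
    then show ?thesis using isCont_cong[OF ev] by blast
  qed
  show ?thesis
    using assms by (cases rule: sphere_holomorphic_atE) (auto intro: * isCont_Cplx isCont_chart_infty)
qed

text \<open>A holomorphic coordinate of the whole sphere without the point \<open>p\<close>, the complex number \<open>w\<close>
  tending to infinity exactly when the point tends to \<open>p\<close>. For \<open>p = Cplx c\<close> it is the inverse of
  \<open>z \<mapsto> 1 / (z - c)\<close>.\<close>
fun affine_chart :: "riemann_sphere \<Rightarrow> complex \<Rightarrow> riemann_sphere" where
  "affine_chart Infty w = Cplx w"
| "affine_chart (Cplx c) w = (if w = 0 then Infty else Cplx (c + 1 / w))"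

lemma inj_affine_chart: "inj (affine_chart p)"
  by (cases p) (auto simp: inj_def)

lemma sphere_holomorphic_at_affine_chart: "sphere_holomorphic_at (affine_chart p) w"
proof (cases p)
  case Infty
  then show ?thesis by (intro sphere_holomorphic_at_Cplx[of "\<lambda>z. z"]) auto
next
  case (Cplx c)
  show ?thesis
  proof (cases "w = 0")
    case False
    have "\<forall>\<^sub>F z in nhds w. z \<noteq> 0" using False by (rule t1_space_nhds)
    then have "\<forall>\<^sub>F z in nhds w. affine_chart p z = Cplx (c + 1 / z)"
      by eventually_elim (simp add: Cplx)
    then show ?thesis
      using False by (intro sphere_holomorphic_at_Cplx) (auto intro!: analytic_intros)
  next
    case True
    have an: "(\<lambda>z. 1 + c * z) analytic_on {w}" by (auto intro!: analytic_intros)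
    \<comment> \<open>In the chart at \<open>Infty\<close> the point \<open>c + 1 / z\<close> has the coordinate \<open>z / (1 + c * z)\<close>.\<close>
    have "\<forall>\<^sub>F z in nhds w. 1 + c * z \<noteq> 0"
      using True by (intro analytic_at_eventually_compose[OF an] t1_space_nhds) simp
    then have "\<forall>\<^sub>F z in nhds w. affine_chart p z = chart_infty (z / (1 + c * z))"
      by eventually_elim (auto simp: Cplx chart_infty_def field_simps)
    then show ?thesis
      using True by (intro sphere_holomorphic_at_chart_infty) (auto intro!: analytic_intros)
  qed
qed

lemma continuous_on_affine_chart: "continuous_on S (affine_chart p)"
  using isCont_sphere_holomorphic_at[OF sphere_holomorphic_at_affine_chart]
  by (intro continuous_at_imp_continuous_on) auto

lemma affine_chart_tendsto: "(affine_chart p \<longlongrightarrow> p) at_infinity"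
proof (cases p)
  case Infty
  have "((\<lambda>w. chart_infty (inverse w)) \<longlongrightarrow> chart_infty 0) at_infinity"
    by (rule isCont_tendsto_compose[OF isCont_chart_infty tendsto_inverse_0])
  moreover have "\<forall>\<^sub>F w in at_infinity. chart_infty (inverse w) = affine_chart p w"
    using eventually_not_equal_at_infinity[of 0]
    by eventually_elim (simp add: Infty Cplx_eq_chart_infty_inverse)
  ultimately have "(affine_chart p \<longlongrightarrow> chart_infty 0) at_infinity"
    by (rule Lim_transform_eventually)
  then show ?thesis by (simp add: chart_infty_def Infty)
next
  case (Cplx c)
  have "((\<lambda>w. c + inverse w) \<longlongrightarrow> c + 0) at_infinity"
    by (intro tendsto_intros tendsto_inverse_0)
  then have "((\<lambda>w. Cplx (c + inverse w)) \<longlongrightarrow> Cplx (c + 0)) at_infinity"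
    by (rule isCont_tendsto_compose[OF isCont_Cplx])
  moreover have "\<forall>\<^sub>F w in at_infinity. Cplx (c + inverse w) = affine_chart p w"
    using eventually_not_equal_at_infinity[of 0]
    by eventually_elim (simp add: Cplx divide_inverse)
  ultimately have "(affine_chart p \<longlongrightarrow> Cplx (c + 0)) at_infinity"
    by (rule Lim_transform_eventually)
  then show ?thesis by (simp add: Cplx)
qed

text \<open>Large coordinates lie near \<open>p\<close>: omitting a ball about \<open>p\<close> bounds the coordinate.\<close>
lemma affine_chart_bounded:
  assumes "\<delta> > 0"
  obtains M where "\<And>w. dist (affine_chart p w) p \<ge> \<delta> \<Longrightarrow> norm w \<le> M"
proof -
  have "\<forall>\<^sub>F w in at_infinity. dist (affine_chart p w) p < \<delta>"
    using affine_chart_tendsto assms by (rule tendstoD)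
  then obtain M where "\<And>w. norm w \<ge> M \<Longrightarrow> dist (affine_chart p w) p < \<delta>"
    by (auto simp: eventually_at_infinity)
  then show ?thesis by (intro that[of M]) (meson linorder_not_le nle_le)
qed

text \<open>As long as a holomorphic map avoids \<open>p\<close>, its affine coordinate is an ordinary holomorphic
  function: \<open>H\<close> and \<open>1 / (H - c)\<close> if the map is given by \<open>H\<close> in the chart \<open>Cplx\<close>, and
  \<open>1 / H\<close> and \<open>H / (1 - c * H)\<close> if it is given by \<open>H\<close> in the chart at \<open>Infty\<close>.\<close>
lemma sphere_holomorphic_at_lift:
  assumes "sphere_holomorphic_at g a" and "g a \<noteq> p"
  obtains G where "G analytic_on {a}" "\<forall>\<^sub>F z in nhds a. g z = affine_chart p (G z)"
  using assms(1)
proof (cases rule: sphere_holomorphic_atE)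
  case (Cplx H)
  show ?thesis
  proof (cases p)
    case Infty
    then show ?thesis using Cplx by (intro that[of H]) auto
  next
    case p: (Cplx c)
    have "H a \<noteq> c" using eventually_nhds_x_imp_x[OF Cplx(2)] assms(2) p by auto
    then have ev: "\<forall>\<^sub>F z in nhds a. H z \<noteq> c"
      by (intro analytic_at_eventually_compose[OF Cplx(1)] t1_space_nhds)
    show ?thesis
    proof (rule that)
      show "(\<lambda>z. 1 / (H z - c)) analytic_on {a}"
        using \<open>H a \<noteq> c\<close> Cplx(1) by (intro analytic_intros) auto
      show "\<forall>\<^sub>F z in nhds a. g z = affine_chart p (1 / (H z - c))"
        using ev Cplx(2) by eventually_elim (simp add: p)
    qed
  qed
next
  case (chart_infty H)
  have ga: "g a = chart_infty (H a)" using chart_infty(2) by (rule eventually_nhds_x_imp_x)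
  show ?thesis
  proof (cases p)
    case Infty
    have "H a \<noteq> 0" using ga assms(2) Infty by (auto simp: chart_infty_def)
    then have ev: "\<forall>\<^sub>F z in nhds a. H z \<noteq> 0"
      by (intro analytic_at_eventually_compose[OF chart_infty(1)] t1_space_nhds)
    show ?thesis
    proof (rule that)
      show "(\<lambda>z. inverse (H z)) analytic_on {a}"
        using \<open>H a \<noteq> 0\<close> chart_infty(1) by (intro analytic_intros) auto
      show "\<forall>\<^sub>F z in nhds a. g z = affine_chart p (inverse (H z))"
        using ev chart_infty(2)
        by eventually_elim (simp add: Infty chart_infty_eq_Cplx_inverse)
    qed
  next
    case p: (Cplx c)
    have "1 - c * H a \<noteq> 0"
      using ga assms(2) p by (auto simp: chart_infty_def divide_simps split: if_splits)
    moreover have an: "(\<lambda>z. 1 - c * H z) analytic_on {a}"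
      using chart_infty(1) by (intro analytic_intros)
    ultimately have ev: "\<forall>\<^sub>F z in nhds a. 1 - c * H z \<noteq> 0"
      by (intro analytic_at_eventually_compose[OF an] t1_space_nhds)
    show ?thesis
    proof (rule that)
      show "(\<lambda>z. H z / (1 - c * H z)) analytic_on {a}"
        using \<open>1 - c * H a \<noteq> 0\<close> chart_infty(1) by (intro analytic_intros) auto
      show "\<forall>\<^sub>F z in nhds a. g z = affine_chart p (H z / (1 - c * H z))"
        using ev chart_infty(2)
        by eventually_elim (auto simp: p chart_infty_def field_simps)
    qed
  qed
qed


section \<open>Holomorphic maps from the sphere to itself\<close>

definition charts :: "(complex \<Rightarrow> riemann_sphere) set" where
  "charts = {Cplx, chart_infty}"

lemma chart_at:
  obtains \<kappa> b where "\<kappa> \<in> charts" "\<kappa> b = z"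
proof (cases z)
  case (Cplx a)
  then show ?thesis by (intro that[of Cplx a]) (auto simp: charts_def)
next
  case Infty
  then show ?thesis by (intro that[of chart_infty 0]) (auto simp: charts_def chart_infty_def)
qed

lemma chart_simps:
  assumes "\<kappa> \<in> charts"
  shows inj_chart: "inj \<kappa>" and isCont_chart: "isCont \<kappa> a"
    and open_chart_image: "open V \<Longrightarrow> open (\<kappa> ` V)"
    and filtermap_chart_nhds: "filtermap \<kappa> (nhds a) = nhds (\<kappa> a)"
  using assms inj_Cplx inj_chart_infty isCont_Cplx isCont_chart_infty open_Cplx_image
    open_chart_infty_image filtermap_Cplx_nhds filtermap_chart_infty_nhds
  by (auto simp: charts_def)

lemma eventually_chart_iff:
  assumes "\<kappa> \<in> charts"
  shows "eventually P (nhds (\<kappa> b)) \<longleftrightarrow> (\<forall>\<^sub>F w in nhds b. P (\<kappa> w))"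
  by (simp add: filtermap_chart_nhds[OF assms, symmetric] eventually_filtermap)

lemma eventually_at_chart_iff:
  assumes "\<kappa> \<in> charts"
  shows "eventually P (at (\<kappa> b)) \<longleftrightarrow> (\<forall>\<^sub>F w in at b. P (\<kappa> w))"
  using inj_chart[OF assms]
  by (simp add: eventually_at_filter eventually_chart_iff[OF assms] inj_eq)

lemma at_sphere_neq_bot: "at (z :: riemann_sphere) \<noteq> bot"
proof -
  obtain \<kappa> b where \<kappa>: "\<kappa> \<in> charts" "\<kappa> b = z" by (rule chart_at)
  show ?thesis
    using eventually_at_chart_iff[OF \<kappa>(1), of "\<lambda>_. False" b] \<kappa>(2)
    by (auto simp: trivial_limit_def[symmetric] eventually_False)
qed

text \<open>Finite points are tested in the chart \<open>Cplx\<close> only. The other chart gives the same answer where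
  both apply (\<open>holomorphic_map_at_chart_iff\<close>), so local statements can be proved in any
  chart about the point.\<close>
fun holomorphic_map_at :: "(riemann_sphere \<Rightarrow> riemann_sphere) \<Rightarrow> riemann_sphere \<Rightarrow> bool" where
  "holomorphic_map_at f (Cplx a) \<longleftrightarrow> sphere_holomorphic_at (\<lambda>z. f (Cplx z)) a"
| "holomorphic_map_at f Infty \<longleftrightarrow> sphere_holomorphic_at (\<lambda>w. f (chart_infty w)) 0"

lemma holomorphic_map_at_chart_iff:
  assumes "\<kappa> \<in> charts"
  shows "holomorphic_map_at f (\<kappa> b) \<longleftrightarrow> sphere_holomorphic_at (\<lambda>w. f (\<kappa> w)) b"
proof -
  consider "\<kappa> = Cplx" | "\<kappa> = chart_infty" "b = 0" | "\<kappa> = chart_infty" "b \<noteq> 0"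
    using assms by (auto simp: charts_def)
  then show ?thesis
  proof cases
    case 3
    \<comment> \<open>Away from \<open>0\<close> the two charts differ by the inversion of the plane, which is its own inverse.\<close>
    have an: "inverse analytic_on {c}" if "c \<noteq> 0" for c :: complex
      using that by (intro analytic_intros) auto
    have ev: "\<forall>\<^sub>F w in nhds b. f (chart_infty w) = f (Cplx (inverse w))"
      using t1_space_nhds[OF 3(2)] by eventually_elim (simp add: chart_infty_eq_Cplx_inverse)
    have ev': "\<forall>\<^sub>F w in nhds (inverse b). f (Cplx w) = f (chart_infty (inverse w))"
      using t1_space_nhds[of "inverse b" 0] 3(2)
      by (auto simp: Cplx_eq_chart_infty_inverse elim: eventually_mono)
    have "holomorphic_map_at f (\<kappa> b) \<longleftrightarrow> sphere_holomorphic_at (\<lambda>z. f (Cplx z)) (inverse b)"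
      using 3 by (simp add: chart_infty_eq_Cplx_inverse)
    also have "\<dots> \<longleftrightarrow> sphere_holomorphic_at (\<lambda>w. f (chart_infty w)) b"
    proof
      assume "sphere_holomorphic_at (\<lambda>z. f (Cplx z)) (inverse b)"
      from sphere_holomorphic_at_compose[of _ inverse, OF this an[OF 3(2)]]
      show "sphere_holomorphic_at (\<lambda>w. f (chart_infty w)) b"
        by (rule sphere_holomorphic_at_transform[OF _ ev])
    next
      assume "sphere_holomorphic_at (\<lambda>w. f (chart_infty w)) b"
      then have "sphere_holomorphic_at (\<lambda>w. f (chart_infty w)) (inverse (inverse b))" by simp
      from sphere_holomorphic_at_compose[of _ inverse, OF this an] 3(2)
      show "sphere_holomorphic_at (\<lambda>z. f (Cplx z)) (inverse b)"
        by (intro sphere_holomorphic_at_transform[OF _ ev']) auto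
    qed
    finally show ?thesis using 3 by simp
  qed (auto simp: chart_infty_def)
qed

lemma holomorphic_map_at_transform:
  assumes "holomorphic_map_at g z" and "\<forall>\<^sub>F x in nhds z. f x = g x"
  shows "holomorphic_map_at f z"
proof -
  obtain \<kappa> b where \<kappa>: "\<kappa> \<in> charts" "\<kappa> b = z" by (rule chart_at)
  show ?thesis
    using assms unfolding \<kappa>(2)[symmetric] holomorphic_map_at_chart_iff[OF \<kappa>(1)]
      eventually_chart_iff[OF \<kappa>(1)]
    by (rule sphere_holomorphic_at_transform)
qed

lemma isCont_holomorphic_map_at:
  assumes "holomorphic_map_at f z"
  shows "isCont f z"
proof -
  obtain \<kappa> b where \<kappa>: "\<kappa> \<in> charts" "\<kappa> b = z" by (rule chart_at)
  have "isCont (\<lambda>w. f (\<kappa> w)) b"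
    using assms unfolding \<kappa>(2)[symmetric] holomorphic_map_at_chart_iff[OF \<kappa>(1)]
    by (rule isCont_sphere_holomorphic_at)
  then have "((\<lambda>w. f (\<kappa> w)) \<longlongrightarrow> f (\<kappa> b)) (nhds b)"
    by (simp add: continuous_at tendsto_at_iff_tendsto_nhds[of "\<lambda>w. f (\<kappa> w)"])
  then have "(f \<longlongrightarrow> f (\<kappa> b)) (nhds (\<kappa> b))"
    by (simp add: filtermap_chart_nhds[OF \<kappa>(1), symmetric] filterlim_filtermap)
  then show ?thesis
    by (simp add: continuous_at tendsto_at_iff_tendsto_nhds \<kappa>(2))
qed

lemma holomorphic_map_at_Infty_dichotomy:
  assumes "holomorphic_map_at f z"
  shows "(\<forall>\<^sub>F x in nhds z. f x = Infty) \<or> (\<forall>\<^sub>F x in at z. f x \<noteq> Infty)"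
proof -
  obtain \<kappa> b where \<kappa>: "\<kappa> \<in> charts" "\<kappa> b = z" by (rule chart_at)
  show ?thesis
    using assms unfolding \<kappa>(2)[symmetric] holomorphic_map_at_chart_iff[OF \<kappa>(1)]
      eventually_chart_iff[OF \<kappa>(1)] eventually_at_chart_iff[OF \<kappa>(1)]
    by (rule sphere_holomorphic_at_Infty_dichotomy)
qed

text \<open>This lets the two kinds of limits of a normal family, meromorphic functions and the constant
  \<open>Infty\<close>, be treated as one class.\<close>
lemma meromorphic_funs_iff:
  "f \<in> meromorphic_funs D \<longleftrightarrow>
     (\<forall>z\<in>D. holomorphic_map_at f z \<and> \<not> (\<forall>\<^sub>F x in nhds z. f x = Infty))"
proof -
  have "(\<forall>z\<in>D. P z) \<longleftrightarrow> (\<forall>a. Cplx a \<in> D \<longrightarrow> P (Cplx a)) \<and> (Infty \<in> D \<longrightarrow> P Infty)" for P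
    by (metis riemann_sphere.exhaust)
  moreover have "eventually P (nhds Infty) \<longleftrightarrow> (\<forall>\<^sub>F w in nhds 0. P (chart_infty w))" for P
    using eventually_chart_iff[of chart_infty P 0] by (simp add: charts_def chart_infty_def)
  moreover have "eventually P (nhds (Cplx a)) \<longleftrightarrow> (\<forall>\<^sub>F w in nhds a. P (Cplx w))" for P a
    by (rule eventually_chart_iff) (simp add: charts_def)
  ultimately show ?thesis
    by (simp add: meromorphic_funs_def meromorphic_at_iff)
qed

text \<open>The points near which \<open>g\<close> is \<open>Infty\<close> and the points with a punctured neighbourhood where
  \<open>g\<close> is finite form two disjoint open sets that cover \<open>D\<close>. They are disjoint because the sphere
  has no isolated points.\<close>
lemma meromorphic_or_Infty:
  assumes "connected D" and hol: "\<And>z. z \<in> D \<Longrightarrow> holomorphic_map_at g z"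
  shows "g \<in> meromorphic_funs D \<or> (\<forall>z\<in>D. g z = Infty)"
proof -
  define A where "A = {z. \<forall>\<^sub>F x in nhds z. g x = Infty}"
  define B where "B = {z. \<forall>\<^sub>F x in at z. g x \<noteq> Infty}"
  have "\<exists>T. open T \<and> z \<in> T \<and> T \<subseteq> A" if zA: "z \<in> A" for z
  proof -
    have "\<exists>S. open S \<and> z \<in> S \<and> (\<forall>x\<in>S. g x = Infty)"
      using zA unfolding A_def mem_Collect_eq eventually_nhds .
    then obtain S where S: "open S" "z \<in> S" "\<forall>x\<in>S. g x = Infty"
      by (elim exE conjE)
    have "y \<in> A" if "y \<in> S" for y
      unfolding A_def mem_Collect_eq eventually_nhds by (intro exI[of _ S] conjI S that)
    with S(1,2) show ?thesis by blast
  qed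
  then have "open A" unfolding open_subopen[of A] by (rule ballI)
  have "\<exists>T. open T \<and> z \<in> T \<and> T \<subseteq> B" if zB: "z \<in> B" for z
  proof -
    have "\<exists>S. open S \<and> z \<in> S \<and> (\<forall>x\<in>S. x \<noteq> z \<longrightarrow> x \<in> UNIV \<longrightarrow> g x \<noteq> Infty)"
      using zB unfolding B_def mem_Collect_eq eventually_at_topological .
    then obtain S where S: "open S" "z \<in> S" "\<forall>x\<in>S. x \<noteq> z \<longrightarrow> x \<in> UNIV \<longrightarrow> g x \<noteq> Infty"
      by (elim exE conjE)
    have "y \<in> B" if "y \<in> S" for y
    proof (cases "y = z")
      case False
      have "\<forall>\<^sub>F x in nhds y. x \<in> S - {z}"
        using S(1) that False by (intro eventually_nhds_in_open) auto
      then have "\<forall>\<^sub>F x in nhds y. g x \<noteq> Infty" by (rule eventually_mono) (simp add: S(3))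
      then show ?thesis by (simp add: B_def eventually_nhds_conv_at)
    qed (simp add: zB)
    then show ?thesis using S(1,2) by blast
  qed
  then have "open B" unfolding open_subopen[of B] by (rule ballI)
  have "z \<in> A \<or> z \<in> B" if "z \<in> D" for z
    using holomorphic_map_at_Infty_dichotomy[OF hol[OF that]] unfolding A_def B_def mem_Collect_eq .
  then have cover: "D \<subseteq> A \<union> B" by blast
  have "\<not> (z \<in> A \<and> z \<in> B)" for z
  proof
    assume "z \<in> A \<and> z \<in> B"
    then have "\<forall>\<^sub>F x in at z. g x = Infty" "\<forall>\<^sub>F x in at z. g x \<noteq> Infty"
      unfolding A_def B_def mem_Collect_eq eventually_nhds_conv_at by blast+
    then have "\<forall>\<^sub>F x in at z. False" by eventually_elim simp
    then show False using at_sphere_neq_bot by (simp add: eventually_False)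
  qed
  then have "A \<inter> B \<inter> D = {}" by blast
  from connectedD[OF \<open>connected D\<close> \<open>open A\<close> \<open>open B\<close> this cover]
  show ?thesis
  proof
    assume "A \<inter> D = {}"
    then have "\<not> (\<forall>\<^sub>F x in nhds z. g x = Infty)" if "z \<in> D" for z
      using that unfolding A_def by blast
    then show ?thesis using hol unfolding meromorphic_funs_iff by blast
  next
    assume "B \<inter> D = {}"
    then have "z \<in> A" if "z \<in> D" for z using cover that by blast
    then have "g z = Infty" if "z \<in> D" for z
      using that eventually_nhds_x_imp_x unfolding A_def mem_Collect_eq by fast
    then show ?thesis by blast
  qed
qed

section \<open>Locally convergent subsequences\<close>

text \<open>The affine coordinates of the maps are holomorphic and uniformly bounded, so a subsequence of
  them converges. All coordinates stay in one compact disc, where \<open>affine_chart\<close> is uniformly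
  continuous; so convergence carries over to the spherical metric.\<close>
lemma Montel_avoiding_ball:
  fixes f :: "nat \<Rightarrow> complex \<Rightarrow> riemann_sphere"
  assumes "r > 0" and "\<delta> > 0"
    and hol: "\<And>n w. w \<in> ball b r \<Longrightarrow> sphere_holomorphic_at (f n) w"
    and avoid: "\<And>n w. w \<in> ball b r \<Longrightarrow> dist (f n w) p \<ge> \<delta>"
  obtains k g where "strict_mono k" "uniform_limit (ball b (r / 2)) (f \<circ> k) g sequentially"
    "\<And>w. w \<in> ball b (r / 2) \<Longrightarrow> sphere_holomorphic_at g w"
proof -
  obtain M where M: "\<And>w. dist (affine_chart p w) p \<ge> \<delta> \<Longrightarrow> norm w \<le> M"
    using affine_chart_bounded[OF \<open>\<delta> > 0\<close>] by blast
  define G where "G = (\<lambda>n w. inv (affine_chart p) (f n w))"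
  have G: "G n analytic_on {w} \<and> f n w = affine_chart p (G n w)" if w: "w \<in> ball b r" for n w
  proof -
    have "f n w \<noteq> p" using avoid[OF w, of n] \<open>\<delta> > 0\<close> by auto
    then obtain K where K: "K analytic_on {w}" "\<forall>\<^sub>F z in nhds w. f n z = affine_chart p (K z)"
      using sphere_holomorphic_at_lift[OF hol[OF w]] by blast
    from K(2) have ev: "\<forall>\<^sub>F z in nhds w. G n z = K z"
      by eventually_elim (simp add: G_def inj_affine_chart)
    then have "G n analytic_on {w}" using K(1) analytic_at_cong[OF ev] by simp
    moreover have "f n w = affine_chart p (G n w)"
      using eventually_nhds_x_imp_x[OF ev] eventually_nhds_x_imp_x[OF K(2)] by simp
    ultimately show ?thesis ..
  qed
  have norm_G: "norm (G n w) \<le> M" if "w \<in> ball b r" for n w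
    using M[of "G n w"] avoid[OF that, of n] G[OF that, of n] by simp
  have "G n holomorphic_on ball b r" for n
    using G by (auto intro!: analytic_imp_holomorphic simp: analytic_on_analytic_at[of _ "ball b r"])
  moreover have "\<exists>B. \<forall>h\<in>range G. \<forall>z\<in>K. norm (h z) \<le> B" if "K \<subseteq> ball b r" for K
    using norm_G that by (intro exI[of _ M]) auto
  ultimately obtain H k where H: "H holomorphic_on ball b r" and k: "strict_mono k"
    and lim: "\<And>K. compact K \<Longrightarrow> K \<subseteq> ball b r \<Longrightarrow> uniform_limit K (G \<circ> k) H sequentially"
    by (rule_tac Montel[of "ball b r" "range G" G]) auto
  have sub: "ball b (r / 2) \<subseteq> cball b (r / 2)" "cball b (r / 2) \<subseteq> ball b r"
    using \<open>r > 0\<close> by (auto simp: subset_iff)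
  have "uniform_limit (ball b (r / 2)) (G \<circ> k) H sequentially"
    using lim[OF compact_cball sub(2)] sub(1) by (rule uniform_limit_on_subset)
  moreover have "uniformly_continuous_on (cball 0 M) (affine_chart p)"
    by (intro compact_uniformly_continuous continuous_on_affine_chart compact_cball)
  ultimately have "uniform_limit (ball b (r / 2)) (\<lambda>n w. affine_chart p ((G \<circ> k) n w))
      (\<lambda>w. affine_chart p (H w)) sequentially"
    by (rule uniform_limit_compose_uniformly_continuous_on)
       (use sub norm_G in \<open>auto simp: subset_iff\<close>)
  also have "?this \<longleftrightarrow> uniform_limit (ball b (r / 2)) (f \<circ> k) (\<lambda>w. affine_chart p (H w)) sequentially"
    by (rule uniform_limit_cong') (use sub G in \<open>auto simp: subset_iff\<close>)
  finally have "uniform_limit (ball b (r / 2)) (f \<circ> k) (\<lambda>w. affine_chart p (H w)) sequentially" .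
  moreover have "sphere_holomorphic_at (\<lambda>w. affine_chart p (H w)) w" if "w \<in> ball b (r / 2)" for w
  proof (rule sphere_holomorphic_at_compose[OF sphere_holomorphic_at_affine_chart])
    show "H analytic_on {w}"
      using H that sub by (auto simp: analytic_at intro!: exI[of _ "ball b r"])
  qed
  ultimately show ?thesis by (rule that[OF k])
qed


section \<open>Normality implies the alternative\<close>

lemma uniform_limit_tendsto_at:
  fixes g :: "'a::metric_space \<Rightarrow> 'b::metric_space"
  assumes ul: "uniform_limit U f g sequentially" and U: "open U" "a \<in> U"
    and g: "isCont g a" and x: "x \<longlonglongrightarrow> a"
  shows "(\<lambda>n. f n (x n)) \<longlonglongrightarrow> g a"
proof (rule tendstoI)
  fix e :: real assume e: "e > 0"
  have "(\<lambda>n. g (x n)) \<longlonglongrightarrow> g a" using g x by (rule isCont_tendsto_compose)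
  then have "\<forall>\<^sub>F n in sequentially. dist (g (x n)) (g a) < e / 2"
    using e by (intro tendstoD) auto
  moreover have "\<forall>\<^sub>F n in sequentially. x n \<in> U"
    using x U by (rule topological_tendstoD)
  moreover have "\<forall>\<^sub>F n in sequentially. \<forall>y\<in>U. dist (f n y) (g y) < e / 2"
    using e by (intro uniform_limitD[OF ul]) auto
  ultimately show "\<forall>\<^sub>F n in sequentially. dist (f n (x n)) (g a) < e"
  proof eventually_elim
    case (elim n)
    have "dist (f n (x n)) (g a) \<le> dist (f n (x n)) (g (x n)) + dist (g (x n)) (g a)"
      by (rule dist_triangle)
    then show ?case using elim by force
  qed
qed

text \<open>The values of \<open>\<epsilon>1\<close> and \<open>\<epsilon>2\<close> are arbitrary: points where the alternative fails on shrinking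
  discs converge to \<open>z0\<close>, and in the limit both inequalities would hold at \<open>z0\<close>.\<close>
lemma normal_imp_separated_or_close:
  assumes "open D" and normal: "normal_family D F"
    and h: "isCont h z0" and z0: "z0 \<in> D" and \<epsilon>: "\<epsilon>1 < \<epsilon>2"
  shows "\<exists>r>0. disc z0 r \<subseteq> D \<and>
      (\<forall>f\<in>F. (\<forall>z\<in>disc z0 r. dist (f z) (h z) > \<epsilon>1) \<or> (\<forall>z\<in>disc z0 r. dist (f z) (h z) < \<epsilon>2))"
proof (rule ccontr)
  assume neg: "\<not> ?thesis"
  obtain R where R: "R > 0" "disc z0 R \<subseteq> D"
    using eventually_nhds_in_open[OF \<open>open D\<close> z0] by (auto simp: eventually_nhds_disc)
  define \<rho> where "\<rho> n = R / real (Suc n)" for n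
  have \<rho>: "\<rho> n > 0" "disc z0 (\<rho> n) \<subseteq> D" for n
  proof -
    show "\<rho> n > 0" using R(1) by (simp add: \<rho>_def)
    have "\<rho> n \<le> R" using R(1) by (simp add: \<rho>_def field_simps)
    then show "disc z0 (\<rho> n) \<subseteq> D" using disc_mono R(2) by blast
  qed
  have "\<exists>f x y. f \<in> F \<and> x \<in> disc z0 (\<rho> n) \<and> y \<in> disc z0 (\<rho> n) \<and>
      dist (f x) (h x) \<le> \<epsilon>1 \<and> dist (f y) (h y) \<ge> \<epsilon>2" for n
    using neg \<rho>[of n] by (meson linorder_not_le)
  then obtain f x y where f: "\<And>n. f n \<in> F"
    and xy: "\<And>n. x n \<in> disc z0 (\<rho> n)" "\<And>n. y n \<in> disc z0 (\<rho> n)"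
    and dx: "\<And>n. dist (f n (x n)) (h (x n)) \<le> \<epsilon>1"
    and dy: "\<And>n. dist (f n (y n)) (h (y n)) \<ge> \<epsilon>2"
    by metis
  have lim: "u \<longlonglongrightarrow> z0" if u: "\<And>n. u n \<in> disc z0 (\<rho> n)" for u
    unfolding filterlim_iff
  proof (intro allI impI)
    fix P assume "eventually P (nhds z0)"
    then obtain r where r: "r > 0" "\<forall>z\<in>disc z0 r. P z" by (auto simp: eventually_nhds_disc)
    have "\<rho> \<longlonglongrightarrow> 0" unfolding \<rho>_def
      by (rule LIMSEQ_Suc[OF lim_const_over_n])
    then have "\<forall>\<^sub>F n in sequentially. \<rho> n < r" using r(1) by (rule order_tendstoD)
    then show "\<forall>\<^sub>F n in sequentially. P (u n)"
    proof eventually_elim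
      case (elim n)
      then have "u n \<in> disc z0 r" using u[of n] disc_mono[of "\<rho> n" r z0] by auto
      then show ?case using r(2) by blast
    qed
  qed
  obtain k g where k: "strict_mono k" and loc: "locally_uniform_limit D (f \<circ> k) g"
    and g: "g \<in> meromorphic_funs D \<or> (\<forall>z\<in>D. g z = Infty)"
    using normal f unfolding normal_family_def by (metis image_subsetI)
  obtain U where U: "open U" "z0 \<in> U" "U \<subseteq> D" and ul: "uniform_limit U (f \<circ> k) g sequentially"
    using loc z0 unfolding locally_uniform_limit_def by metis
  have "isCont g z0"
    using g
  proof
    assume "g \<in> meromorphic_funs D"
    then show ?thesis using z0 isCont_holomorphic_map_at by (auto simp: meromorphic_funs_iff)
  next
    assume "\<forall>z\<in>D. g z = Infty"
    then have "\<forall>\<^sub>F z in nhds z0. g z = Infty"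
      using eventually_nhds_in_open[OF \<open>open D\<close> z0] by (auto elim: eventually_mono)
    from isCont_cong[OF this] show ?thesis by simp
  qed
  have tends: "(\<lambda>n. dist (f (k n) (u (k n))) (h (u (k n)))) \<longlonglongrightarrow> dist (g z0) (h z0)"
    if u: "\<And>n. u n \<in> disc z0 (\<rho> n)" for u
  proof (rule tendsto_dist)
    have uk: "(\<lambda>n. u (k n)) \<longlonglongrightarrow> z0"
      using LIMSEQ_subseq_LIMSEQ[OF lim[OF u] k] by (simp add: o_def)
    show "(\<lambda>n. f (k n) (u (k n))) \<longlonglongrightarrow> g z0"
      using uniform_limit_tendsto_at[OF ul U(1,2) \<open>isCont g z0\<close> uk] by simp
    show "(\<lambda>n. h (u (k n))) \<longlonglongrightarrow> h z0"
      using h uk by (rule isCont_tendsto_compose)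
  qed
  have "dist (g z0) (h z0) \<le> \<epsilon>1"
    using tends[OF xy(1)] dx by (intro LIMSEQ_le_const2) auto
  moreover have "dist (g z0) (h z0) \<ge> \<epsilon>2"
    using tends[OF xy(2)] dy by (intro LIMSEQ_le_const) auto
  ultimately show False using \<epsilon> by simp
qed

section \<open>The alternative implies local normality\<close>

text \<open>A distance below \<open>\<epsilon>2 < pi\<close> from a point is a distance above \<open>pi - \<epsilon>2\<close> from its
  antipode. The factor \<open>2\<close> pays for replacing \<open>h z\<close> by the constant \<open>c\<close>.\<close>
lemma separated_or_close_avoids_point:
  fixes f h :: "'a \<Rightarrow> riemann_sphere" and c q :: riemann_sphere
  assumes q: "\<And>x. dist x q = pi - dist x c"
    and h: "\<And>z. z \<in> V \<Longrightarrow> dist (h z) c \<le> \<eta>" and \<eta>: "2 * \<eta> \<le> \<epsilon>1" "2 * \<eta> \<le> pi - \<epsilon>2"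
    and f: "(\<forall>z\<in>V. dist (f z) (h z) > \<epsilon>1) \<or> (\<forall>z\<in>V. dist (f z) (h z) < \<epsilon>2)"
  shows "(\<forall>z\<in>V. dist (f z) c \<ge> \<eta>) \<or> (\<forall>z\<in>V. dist (f z) q \<ge> \<eta>)"
  using f
proof
  assume far: "\<forall>z\<in>V. dist (f z) (h z) > \<epsilon>1"
  have "dist (f z) c \<ge> \<eta>" if "z \<in> V" for z
    using dist_triangle2[of "f z" "h z" c] far[rule_format, OF that] h[OF that] \<eta>(1)
    by linarith
  then show ?thesis by blast
next
  assume close: "\<forall>z\<in>V. dist (f z) (h z) < \<epsilon>2"
  have "dist (f z) q \<ge> \<eta>" if "z \<in> V" for z
    using dist_triangle[of "f z" c "h z"] close[rule_format, OF that] h[OF that] \<eta>(2) q[of "f z"]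
    by linarith
  then show ?thesis by blast
qed

text \<open>A local form of normality: one subsequence for the whole set \<open>U\<close>, uniform convergence on it, and
  limits that are holomorphic maps. Whether the limit is meromorphic or constantly \<open>Infty\<close> is
  a global question, decided on the connected set \<open>D\<close> only after the local limits are glued.\<close>
definition normal_on :: "riemann_sphere set \<Rightarrow> (riemann_sphere \<Rightarrow> riemann_sphere) set \<Rightarrow> bool" where
  "normal_on U F \<longleftrightarrow> (\<forall>s :: nat \<Rightarrow> _. range s \<subseteq> F \<longrightarrow>
     (\<exists>k g. strict_mono (k :: nat \<Rightarrow> nat) \<and> uniform_limit U (s \<circ> k) g sequentially \<and>
        (\<forall>z\<in>U. holomorphic_map_at g z)))"

text \<open>Which of the two balls is omitted depends on the map, but one of them is omitted by infinitely
  many members of any sequence.\<close>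
lemma normal_on_avoiding:
  assumes r: "r > 0" and \<delta>: "\<delta> > 0" and \<kappa>: "\<kappa> \<in> charts"
    and hol: "\<And>f w. f \<in> F \<Longrightarrow> w \<in> ball b r \<Longrightarrow> holomorphic_map_at f (\<kappa> w)"
    and avoid: "\<And>f. f \<in> F \<Longrightarrow> (\<forall>w\<in>ball b r. dist (f (\<kappa> w)) p \<ge> \<delta>) \<or>
                                 (\<forall>w\<in>ball b r. dist (f (\<kappa> w)) q \<ge> \<delta>)"
  shows "normal_on (\<kappa> ` ball b (r / 2)) F"
  unfolding normal_on_def
proof (intro allI impI)
  fix s :: "nat \<Rightarrow> riemann_sphere \<Rightarrow> riemann_sphere"
  assume "range s \<subseteq> F"
  then have s: "s n \<in> F" for n by auto
  define N where "N c = {n. \<forall>w\<in>ball b r. dist (s n (\<kappa> w)) c \<ge> \<delta>}" for c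
  have "N p \<union> N q = UNIV" using avoid[OF s] by (auto simp: N_def)
  then have "infinite (N p) \<or> infinite (N q)"
    by (metis finite_UnI infinite_UNIV_nat)
  then obtain c where "infinite (N c)" by blast
  then obtain e :: "nat \<Rightarrow> nat" where e: "strict_mono e" "\<And>n. e n \<in> N c"
    using infinite_enumerate[OF \<open>infinite (N c)\<close>] by metis
  have "\<And>n w. w \<in> ball b r \<Longrightarrow> sphere_holomorphic_at (\<lambda>w. s (e n) (\<kappa> w)) w"
    using hol[OF s] by (simp add: holomorphic_map_at_chart_iff[OF \<kappa>])
  moreover have "\<And>n w. w \<in> ball b r \<Longrightarrow> dist (s (e n) (\<kappa> w)) c \<ge> \<delta>"
    using e(2) by (simp add: N_def)
  ultimately obtain k H where k: "strict_mono k"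
    and ul: "uniform_limit (ball b (r / 2)) ((\<lambda>n w. s (e n) (\<kappa> w)) \<circ> k) H sequentially"
    and H: "\<And>w. w \<in> ball b (r / 2) \<Longrightarrow> sphere_holomorphic_at H w"
    using Montel_avoiding_ball[OF r \<delta>, of b "\<lambda>n w. s (e n) (\<kappa> w)" c] by blast
  define g where "g z = H (inv \<kappa> z)" for z
  have g\<kappa>: "g (\<kappa> w) = H w" for w
    by (simp add: g_def inv_f_f[OF inj_chart[OF \<kappa>]])
  have "uniform_limit (\<kappa> ` ball b (r / 2)) (s \<circ> (e \<circ> k)) g sequentially"
    using ul by (simp add: uniform_limit_iff g\<kappa>)
  moreover have "\<forall>z\<in>\<kappa> ` ball b (r / 2). holomorphic_map_at g z"
    using H by (auto simp: holomorphic_map_at_chart_iff[OF \<kappa>] g\<kappa>)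
  moreover have "strict_mono (e \<circ> k)" using e(1) k by (rule strict_mono_o)
  ultimately show "\<exists>k g. strict_mono (k :: nat \<Rightarrow> nat) \<and>
      uniform_limit (\<kappa> ` ball b (r / 2)) (s \<circ> k) g sequentially \<and>
      (\<forall>z\<in>\<kappa> ` ball b (r / 2). holomorphic_map_at g z)"
    by blast
qed

lemma separated_or_close_imp_normal_on:
  assumes "open D" and "z0 \<in> D" and F: "F \<subseteq> meromorphic_funs D" and h: "isCont h z0"
    and r: "r > 0" and \<epsilon>: "0 < \<epsilon>1" "\<epsilon>2 < pi"
    and sep: "\<forall>f\<in>F. (\<forall>z\<in>disc z0 r. dist (f z) (h z) > \<epsilon>1) \<or>
                     (\<forall>z\<in>disc z0 r. dist (f z) (h z) < \<epsilon>2)"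
  obtains U where "open U" "z0 \<in> U" "U \<subseteq> D" "normal_on U F"
proof -
  define \<eta> where "\<eta> = min \<epsilon>1 (pi - \<epsilon>2) / 2"
  have \<eta>: "\<eta> > 0" "2 * \<eta> \<le> \<epsilon>1" "2 * \<eta> \<le> pi - \<epsilon>2" using \<epsilon> by (auto simp: \<eta>_def)
  obtain q where q: "\<And>x. dist x q = pi - dist x (h z0)" 
    using ex_antipode[of "h z0"] by metis
  obtain \<kappa> b where \<kappa>: "\<kappa> \<in> charts" "\<kappa> b = z0" by (rule chart_at)
  have "\<forall>\<^sub>F z in nhds z0. dist (h z) (h z0) < \<eta>"
    using h \<eta>(1) by (auto simp: continuous_at tendsto_at_iff_tendsto_nhds intro: tendstoD)
  moreover have "\<forall>\<^sub>F z in nhds z0. z \<in> disc z0 r"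
    using open_disc centre_in_disc[OF r] by (rule eventually_nhds_in_open)
  moreover have "\<forall>\<^sub>F z in nhds z0. z \<in> D"
    using assms(1,2) by (rule eventually_nhds_in_open)
  ultimately have "\<forall>\<^sub>F z in nhds (\<kappa> b). dist (h z) (h z0) < \<eta> \<and> z \<in> disc z0 r \<and> z \<in> D"
    unfolding \<kappa>(2) by eventually_elim simp
  then obtain \<rho> where \<rho>: "\<rho> > 0"
    "\<And>w. w \<in> ball b \<rho> \<Longrightarrow> dist (h (\<kappa> w)) (h z0) < \<eta> \<and> \<kappa> w \<in> disc z0 r \<and> \<kappa> w \<in> D"
    unfolding eventually_chart_iff[OF \<kappa>(1)] by (auto simp: eventually_nhds_metric dist_commute)
  show ?thesis
  proof (rule that)
    show "normal_on (\<kappa> ` ball b (\<rho> / 2)) F"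
    proof (rule normal_on_avoiding[OF \<rho>(1) \<eta>(1) \<kappa>(1)])
      show "holomorphic_map_at f (\<kappa> w)" if "f \<in> F" "w \<in> ball b \<rho>" for f w
        using F that \<rho>(2) by (auto simp: meromorphic_funs_iff)
      fix f assume "f \<in> F"
      show "(\<forall>w\<in>ball b \<rho>. \<eta> \<le> dist (f (\<kappa> w)) (h z0)) \<or> (\<forall>w\<in>ball b \<rho>. \<eta> \<le> dist (f (\<kappa> w)) q)"
      proof (rule separated_or_close_avoids_point[OF q _ \<eta>(2,3)])
        show "dist (h (\<kappa> w)) (h z0) \<le> \<eta>" if "w \<in> ball b \<rho>" for w
          using \<rho>(2)[OF that] by simp
        show "(\<forall>w\<in>ball b \<rho>. \<epsilon>1 < dist (f (\<kappa> w)) (h (\<kappa> w))) \<or>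
              (\<forall>w\<in>ball b \<rho>. dist (f (\<kappa> w)) (h (\<kappa> w)) < \<epsilon>2)"
          using sep \<open>f \<in> F\<close> \<rho>(2) by blast
      qed
    qed
    show "open (\<kappa> ` ball b (\<rho> / 2))" by (intro open_chart_image[OF \<kappa>(1)] open_ball)
    show "z0 \<in> \<kappa> ` ball b (\<rho> / 2)" using \<kappa>(2) \<rho>(1) by force
    show "\<kappa> ` ball b (\<rho> / 2) \<subseteq> D" using \<rho> by force
  qed
qed

section \<open>From local to global\<close>

text \<open>The finite part is covered by countably many sets as the plane has a countable base; one more set
  takes care of \<open>Infty\<close>.\<close>
lemma Lindelof_sphere:
  fixes U :: "riemann_sphere \<Rightarrow> riemann_sphere set"
  assumes U: "\<And>z. z \<in> D \<Longrightarrow> open (U z) \<and> z \<in> U z"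
  obtains C where "countable C" "C \<subseteq> D" "D \<subseteq> (\<Union>z\<in>C. U z)"
proof -
  have "open (Cplx -` V)" if "open V" for V
    using that continuous_on_Cplx[of UNIV] by (simp add: continuous_on_open_vimage)
  then obtain \<C> where C: "\<C> \<subseteq> (\<lambda>z. Cplx -` U z) ` D" "countable \<C>"
      "\<Union>\<C> = (\<Union>z\<in>D. Cplx -` U z)"
    using U by (rule_tac Lindelof[of "(\<lambda>z. Cplx -` U z) ` D"]) auto
  then obtain C where C': "C \<subseteq> D" "countable C" "\<C> = (\<lambda>z. Cplx -` U z) ` C"
    using countable_subset_image[of \<C> "\<lambda>z. Cplx -` U z" D] by blast
  show ?thesis
  proof (rule that)
    show "countable (C \<union> (D \<inter> {Infty}))" using C'(2) by (simp add: countable_Int2)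
    show "C \<union> (D \<inter> {Infty}) \<subseteq> D" using C'(1) by blast
    show "D \<subseteq> (\<Union>z\<in>C \<union> (D \<inter> {Infty}). U z)"
    proof
      fix z assume "z \<in> D"
      show "z \<in> (\<Union>z\<in>C \<union> (D \<inter> {Infty}). U z)"
      proof (cases z)
        case Infty
        then show ?thesis using \<open>z \<in> D\<close> U by auto
      next
        case (Cplx a)
        then have "a \<in> \<Union>\<C>" using \<open>z \<in> D\<close> U C(3) by auto
        then show ?thesis using C'(3) Cplx by auto
      qed
    qed
  qed
qed

text \<open>A diagonal subsequence converges on every member of a countable cover. The local limits agree on
  overlaps because each is the pointwise limit, so together they form one holomorphic map.\<close>
lemma locally_normal_imp_normal:
  assumes "connected D" and "D \<noteq> {}"
    and loc: "\<And>z. z \<in> D \<Longrightarrow> \<exists>U. open U \<and> z \<in> U \<and> U \<subseteq> D \<and> normal_on U F"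
  shows "normal_family D F"
  unfolding normal_family_def
proof (intro allI impI)
  fix s :: "nat \<Rightarrow> riemann_sphere \<Rightarrow> riemann_sphere"
  assume s: "range s \<subseteq> F"
  obtain U where U: "\<And>z. z \<in> D \<Longrightarrow> open (U z) \<and> z \<in> U z"
    and UD: "\<And>z. z \<in> D \<Longrightarrow> U z \<subseteq> D" and UF: "\<And>z. z \<in> D \<Longrightarrow> normal_on (U z) F"
    using loc by metis
  obtain C where C: "countable C" "C \<subseteq> D" "D \<subseteq> (\<Union>z\<in>C. U z)"
    using Lindelof_sphere[OF U] by blast
  have "C \<noteq> {}" using C(3) \<open>D \<noteq> {}\<close> by auto
  define c where "c = from_nat_into C"
  have c: "c i \<in> D" for i
    using from_nat_into[OF \<open>C \<noteq> {}\<close>] C(2) by (auto simp: c_def)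
  have cover: "\<exists>i. z \<in> U (c i)" if "z \<in> D" for z
    using that C(3) from_nat_into_surj[OF C(1)] by (fastforce simp: c_def)
  \<comment> \<open>\<open>P\<close> speaks of the index sequence \<open>r\<close> and not of \<open>s \<circ> r\<close>: the diagonal argument needs the
    extraction property for every sequence of the given type, and only subsequences of \<open>s\<close> are
    known to lie in \<open>F\<close>.\<close>
  define P where "P i r \<longleftrightarrow> (\<exists>g. uniform_limit (U (c i)) (\<lambda>n. s (r n)) g sequentially \<and>
      (\<forall>z\<in>U (c i). holomorphic_map_at g z))" for i and r :: "nat \<Rightarrow> nat"
  obtain k :: "nat \<Rightarrow> nat" where k: "strict_mono k" and Pk: "\<And>i. P i (id \<circ> k)"
  proof (rule subsequence_diagonalization_lemma[of P id])
    fix i and r :: "nat \<Rightarrow> nat"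
    have "range (s \<circ> r) \<subseteq> F" using s by auto
    then obtain k g where "strict_mono (k :: nat \<Rightarrow> nat)"
      "uniform_limit (U (c i)) ((s \<circ> r) \<circ> k) g sequentially" "\<forall>z\<in>U (c i). holomorphic_map_at g z"
      using UF[OF c[of i]] unfolding normal_on_def by metis
    then show "\<exists>k. strict_mono k \<and> P i (r \<circ> k)"
      unfolding P_def by (intro exI[of _ k] conjI exI[of _ g]) (auto simp: o_def)
  next
    fix i N and r k1 k2 :: "nat \<Rightarrow> nat"
    assume P: "P i (r \<circ> k1)" and sub: "\<And>j. N \<le> j \<Longrightarrow> \<exists>j'\<ge>j. k2 j = k1 j'"
    obtain g where g: "uniform_limit (U (c i)) (\<lambda>n. s (r (k1 n))) g sequentially"
      "\<forall>z\<in>U (c i). holomorphic_map_at g z"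
      using P by (auto simp: P_def)
    have "uniform_limit (U (c i)) (\<lambda>n. s (r (k2 n))) g sequentially"
      unfolding uniform_limit_iff eventually_sequentially
    proof (intro allI impI)
      fix e :: real assume "e > 0"
      then obtain M where M: "\<And>n z. n \<ge> M \<Longrightarrow> z \<in> U (c i) \<Longrightarrow> dist (s (r (k1 n)) z) (g z) < e"
        using g(1) unfolding uniform_limit_iff eventually_sequentially by meson
      have "\<forall>z\<in>U (c i). dist (s (r (k2 n)) z) (g z) < e" if "n \<ge> max M N" for n
        using sub[of n] that M by force
      then show "\<exists>M. \<forall>n\<ge>M. \<forall>z\<in>U (c i). dist (s (r (k2 n)) z) (g z) < e" by blast
    qed
    then show "P i (r \<circ> k2)" using g(2) by (auto simp: P_def)
  qed (rule that)
  from Pk have "\<forall>i. \<exists>g. uniform_limit (U (c i)) (s \<circ> k) g sequentially \<and>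
      (\<forall>z\<in>U (c i). holomorphic_map_at g z)"
    by (simp add: P_def o_def)
  then obtain G where ul: "\<And>i. uniform_limit (U (c i)) (s \<circ> k) (G i) sequentially"
    and G: "\<And>i z. z \<in> U (c i) \<Longrightarrow> holomorphic_map_at (G i) z"
    by metis
  define g where "g z = lim (\<lambda>n. s (k n) z)" for z
  have gG: "g z = G i z" if "z \<in> U (c i)" for i z
    using tendsto_uniform_limitI[OF ul that] by (simp add: g_def limI)
  have "locally_uniform_limit D (s \<circ> k) g"
    unfolding locally_uniform_limit_def
  proof
    fix z assume "z \<in> D"
    then obtain i where i: "z \<in> U (c i)" using cover by blast
    have "uniform_limit (U (c i)) (s \<circ> k) g sequentially"
      using ul[of i] gG uniform_limit_cong'[of "U (c i)" "s \<circ> k" "s \<circ> k" g "G i" sequentially] by simp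
    then show "\<exists>U. open U \<and> z \<in> U \<and> U \<subseteq> D \<and> uniform_limit U (s \<circ> k) g sequentially"
      using i U[OF c] UD[OF c] by blast
  qed
  moreover have "holomorphic_map_at g z" if "z \<in> D" for z
  proof -
    obtain i where i: "z \<in> U (c i)" using cover[OF \<open>z \<in> D\<close>] by blast
    have "\<forall>\<^sub>F x in nhds z. x \<in> U (c i)"
      using U[OF c] i by (intro eventually_nhds_in_open) auto
    then have "\<forall>\<^sub>F x in nhds z. g x = G i x" by (rule eventually_mono) (rule gG)
    with G[OF i] show ?thesis by (rule holomorphic_map_at_transform)
  qed
  then have "g \<in> meromorphic_funs D \<or> (\<forall>z\<in>D. g z = Infty)"
    by (rule meromorphic_or_Infty[OF \<open>connected D\<close>])
  ultimately show "\<exists>k g. strict_mono (k :: nat \<Rightarrow> nat) \<and> locally_uniform_limit D (s \<circ> k) g \<and>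
      (g \<in> meromorphic_funs D \<or> (\<forall>z\<in>D. g z = Infty))"
    using k by blast
qed

theorem theorem1p8:
  fixes D :: "riemann_sphere set"
    and F :: "(riemann_sphere \<Rightarrow> riemann_sphere) set"
    and h :: "riemann_sphere \<Rightarrow> riemann_sphere"
  assumes "open D" and "connected D" and "D \<noteq> {}"
    and "F \<subseteq> meromorphic_funs D"
    and "h \<in> meromorphic_funs D"
  shows "normal_family D F \<longleftrightarrow>
    (\<forall>z0\<in>D. \<exists>r>0. disc z0 r \<subseteq> D \<and>
      (\<exists>\<epsilon>1 \<epsilon>2. 0 < \<epsilon>1 \<and> \<epsilon>1 < \<epsilon>2 \<and> \<epsilon>2 < pi \<and>
        (\<forall>f\<in>F. (\<forall>z\<in>disc z0 r. dist (f z) (h z) > \<epsilon>1) \<or>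
                (\<forall>z\<in>disc z0 r. dist (f z) (h z) < \<epsilon>2))))"
    (is "_ \<longleftrightarrow> ?separated")
proof
  have h: "isCont h z" if "z \<in> D" for z
    using assms(5) that isCont_holomorphic_map_at by (auto simp: meromorphic_funs_iff)
  show "?separated" if "normal_family D F"
  proof
    fix z0 assume z0: "z0 \<in> D"
    have \<epsilon>: "0 < pi / 4" "pi / 4 < pi / 2" "pi / 2 < pi" using pi_gt_zero by linarith+
    then show "\<exists>r>0. disc z0 r \<subseteq> D \<and>
      (\<exists>\<epsilon>1 \<epsilon>2. 0 < \<epsilon>1 \<and> \<epsilon>1 < \<epsilon>2 \<and> \<epsilon>2 < pi \<and>
        (\<forall>f\<in>F. (\<forall>z\<in>disc z0 r. dist (f z) (h z) > \<epsilon>1) \<or>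
                (\<forall>z\<in>disc z0 r. dist (f z) (h z) < \<epsilon>2)))"
      using normal_imp_separated_or_close[OF \<open>open D\<close> that h[OF z0] z0 \<epsilon>(2)] by blast
  qed
  show "normal_family D F" if sep: "?separated"
  proof (rule locally_normal_imp_normal[OF \<open>connected D\<close> \<open>D \<noteq> {}\<close>])
    fix z0 assume z0: "z0 \<in> D"
    obtain r \<epsilon>1 \<epsilon>2 where "r > 0" "0 < \<epsilon>1" "\<epsilon>2 < pi"
      "\<forall>f\<in>F. (\<forall>z\<in>disc z0 r. dist (f z) (h z) > \<epsilon>1) \<or> (\<forall>z\<in>disc z0 r. dist (f z) (h z) < \<epsilon>2)"
      using sep[rule_format, OF z0] by blast
    then show "\<exists>U. open U \<and> z0 \<in> U \<and> U \<subseteq> D \<and> normal_on U F"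
      using separated_or_close_imp_normal_on[OF \<open>open D\<close> z0 assms(4) h[OF z0]] by metis
  qed
qed

end
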